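(* Let $n\ge 2$, let $q_1,\ldots,q_{n-1},p_1,\ldots,p_{n-1}$ be the canonical coordinates of the Toda system, put $p_0=0$, and let $$H=2\sum_{i=1}^{n-1}(p_i-p_{i-1})^2+4\sum_{i=1}^{n-1}e^{2q_i}.$$ Substituting $\hat p_i=-i\,\partial_{q_i}$ and $\hat q_i=q_i$ for $p_i$ and $q_i$ in $H$ gives the quantum Hamiltonian $$\hat H=-2\,\partial_{q_1}^2-2\sum_{i=2}^{n-1}\left(\partial_{q_i}-\partial_{q_{i-1}}\right)^2+4\sum_{i=1}^{n-1}e^{2q_i}.$$ In the coordinates $z_1,\ldots,z_{n-1}$ defined by $q_i=z_i-z_{i+1}$ for $i<n-1$ and $q_{n-1}=z_{n-1}$, this operator becomes $$\hat H=-2\sum_{i=1}^{n-1}\partial_{z_i}^2+4\left(\sum_{i=1}^{n-2}e^{2(z_i-z_{i+1})}+e^{2z_{n-1}}\right).$$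
   Context: The Toda system is described by variables $a_i>0$ ($1\le i\le n-1$) and $b_i\in\mathbb{R}$ ($1\le i\le n$) with $\sum_i b_i$ constant; $q_i=\log a_i$ and $p_i=\sum_{j=1}^i b_j$ for $1\le i\le n-1$. The symplectic form is $\sum_{i=1}^{n-1}dq_i\wedge dp_i$. Operators act on smooth functions of $(q_1,\ldots,q_{n-1})\in\mathbb{R}^{n-1}$; $q_i$ as an operator denotes multiplication by $q_i$, and $i$ in $-i\,\partial_{q_i}$ outside the index denotes the imaginary unit. *)

theory Defs
  imports "HOL-Analysis.Analysis"
begin

section \<open>Smooth functions and operators on them\<close>

fun k_times_continuously_differentiable ::
    "nat \<Rightarrow> ('a::real_normed_vector \<Rightarrow> 'b::real_normed_vector) \<Rightarrow> bool" where
  "k_times_continuously_differentiable 0 f \<longleftrightarrow> continuous_on UNIV f"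
| "k_times_continuously_differentiable (Suc k) f \<longleftrightarrow>
     (\<forall>x. f differentiable (at x)) \<and>
     (\<forall>v. k_times_continuously_differentiable k (\<lambda>x. frechet_derivative f (at x) v))"

definition smooth :: "('a::real_normed_vector \<Rightarrow> 'b::real_normed_vector) \<Rightarrow> bool" where
  "smooth f \<longleftrightarrow> (\<forall>k. k_times_continuously_differentiable k f)"

type_synonym 'm wavefun = "real ^ 'm \<Rightarrow> complex"

definition partial :: "'m::finite \<Rightarrow> 'm wavefun \<Rightarrow> 'm wavefun" where
  "partial k f x = vector_derivative (\<lambda>t. f (x + t *\<^sub>R axis k 1)) (at 0)"

definition momentum_op :: "'m::finite \<Rightarrow> 'm wavefun \<Rightarrow> 'm wavefun" where
  "momentum_op k f x = - \<i> * partial k f x"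

definition position_op :: "'m::finite \<Rightarrow> 'm wavefun \<Rightarrow> 'm wavefun" where
  "position_op k f x = complex_of_real (x $ k) * f x"

text \<open>The exponential of an operator is its exponential series, summed pointwise.\<close>

definition op_exp :: "('m::finite wavefun \<Rightarrow> 'm wavefun) \<Rightarrow> 'm wavefun \<Rightarrow> 'm wavefun" where
  "op_exp A f x = (\<Sum>k. (A ^^ k) f x / fact k)"

section \<open>Substitution of numbers or operators for the phase space variables\<close>

text \<open>
  Operators do not commute, so replacing the variables by operators is an operation on the
  expression defining an observable, not on the function of real variables it denotes.
\<close>

datatype phase_expr =
    Const real
  | P nat
  | Q nat
  | Add phase_expr phase_expr
  | Sub phase_expr phase_expr
  | Mult phase_expr phase_expr
  | Power phase_expr nat
  | Exp phase_expr
  | Sum nat nat "nat \<Rightarrow> phase_expr"  \<comment> \<open>\<open>Sum l u E\<close> is the sum of \<open>E i\<close> for \<open>i\<close> from \<open>l\<close> to \<open>u\<close>\<close>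

primrec classical_value :: "(nat \<Rightarrow> real) \<Rightarrow> (nat \<Rightarrow> real) \<Rightarrow> phase_expr \<Rightarrow> real" where
  "classical_value p q (Const c) = c"
| "classical_value p q (P i) = p i"
| "classical_value p q (Q i) = q i"
| "classical_value p q (Add A B) = classical_value p q A + classical_value p q B"
| "classical_value p q (Sub A B) = classical_value p q A - classical_value p q B"
| "classical_value p q (Mult A B) = classical_value p q A * classical_value p q B"
| "classical_value p q (Power A k) = classical_value p q A ^ k"
| "classical_value p q (Exp A) = exp (classical_value p q A)"
| "classical_value p q (Sum l u E) = (\<Sum>i=l..u. classical_value p q (E i))"

primrec quantize ::
    "(nat \<Rightarrow> 'm::finite wavefun \<Rightarrow> 'm wavefun) \<Rightarrow> (nat \<Rightarrow> 'm wavefun \<Rightarrow> 'm wavefun) \<Rightarrow>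
     phase_expr \<Rightarrow> 'm wavefun \<Rightarrow> 'm wavefun" where
  "quantize p q (Const c) = (\<lambda>f x. complex_of_real c * f x)"
| "quantize p q (P i) = p i"
| "quantize p q (Q i) = q i"
| "quantize p q (Add A B) = (\<lambda>f x. quantize p q A f x + quantize p q B f x)"
| "quantize p q (Sub A B) = (\<lambda>f x. quantize p q A f x - quantize p q B f x)"
| "quantize p q (Mult A B) = quantize p q A \<circ> quantize p q B"
| "quantize p q (Power A k) = quantize p q A ^^ k"
| "quantize p q (Exp A) = op_exp (quantize p q A)"
| "quantize p q (Sum l u E) = (\<lambda>f x. \<Sum>i=l..u. quantize p q (E i) f x)"

section \<open>The Toda system\<close>

definition toda_canonical_coordinates ::
    "nat \<Rightarrow> real \<Rightarrow> (nat \<Rightarrow> real) \<Rightarrow> (nat \<Rightarrow> real) \<Rightarrow> (nat \<Rightarrow> real) \<Rightarrow> (nat \<Rightarrow> real) \<Rightarrow> bool" where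
  "toda_canonical_coordinates n c a b q p \<longleftrightarrow>
     (\<forall>i\<in>{1..n-1}. a i > 0) \<and> (\<Sum>i=1..n. b i) = c \<and>
     (\<forall>i\<in>{1..n-1}. q i = ln (a i) \<and> p i = (\<Sum>j=1..i. b j))"

definition toda_H :: "nat \<Rightarrow> phase_expr" where
  "toda_H n =
     Add (Mult (Const 2) (Sum 1 (n-1) (\<lambda>i. Power (Sub (P i) (P (i-1))) 2)))
         (Mult (Const 4) (Sum 1 (n-1) (\<lambda>i. Exp (Mult (Const 2) (Q i)))))"

text \<open>
  The configuration space is \<^typ>\<open>real ^ 'm\<close>, where a bijection \<open>e\<close> from \<open>{1..n-1}\<close> onto
  \<^typ>\<open>'m\<close> numbers the coordinates.  Since \<open>p\<^sub>0 = 0\<close>, the zero operator is substituted for \<open>P 0\<close>.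
\<close>

definition toda_quantum_H :: "nat \<Rightarrow> (nat \<Rightarrow> 'm::finite) \<Rightarrow> 'm wavefun \<Rightarrow> 'm wavefun" where
  "toda_quantum_H n e =
     quantize (\<lambda>i. if i = 0 then (\<lambda>f x. 0) else momentum_op (e i)) (\<lambda>i. position_op (e i)) (toda_H n)"

text \<open>An operator in the coordinates \<open>z\<close> related to the old ones by \<open>q = \<phi> z\<close>.\<close>

definition in_coordinates ::
    "(real ^ 'm \<Rightarrow> real ^ 'm) \<Rightarrow> ('m::finite wavefun \<Rightarrow> 'm wavefun) \<Rightarrow> 'm wavefun \<Rightarrow> 'm wavefun" where
  "in_coordinates \<phi> A g = A (g \<circ> inv \<phi>) \<circ> \<phi>"

end

theory Submission
  imports Defs
begin

text \<open>
  On smooth functions every first-order operator that occurs is a directional derivative.  Put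
  \<open>v i = axis (e i) 1 - axis (e (i-1)) 1\<close> for \<open>i > 1\<close> and \<open>v 1 = axis (e 1) 1\<close>; then both
  \<open>\<partial>\<^sub>i - \<partial>\<^sub>i\<^sub>-\<^sub>1\<close> and, up to the factor \<open>-\<i>\<close>, the quantization of \<open>p\<^sub>i - p\<^sub>i\<^sub>-\<^sub>1\<close> differentiate along
  \<open>v i\<close>, so that squaring the latter gives minus the second derivative along \<open>v i\<close>
  (\<open>momentum_power2\<close>).  The exponential series of a multiplication operator is multiplication by
  the exponential (\<open>op_exp_multiplication\<close>).  This yields the formula for the quantum Hamiltonian.

  For the change of coordinates, differentiating \<open>g \<circ> inv \<phi>\<close> along \<open>v\<close> amounts to differentiating
  \<open>g\<close> along \<open>inv \<phi> v\<close>.  The coordinates \<open>z\<close> are chosen exactly so that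
  \<open>\<phi> (axis (e i) 1) = v i\<close> (\<open>toda_shift_axis\<close>), whence the second derivative along \<open>v i\<close> becomes
  \<open>\<partial>\<^sup>2/\<partial>z\<^sub>i\<^sup>2\<close> and the mixed derivatives disappear.
\<close>

section \<open>Directional derivatives of smooth functions\<close>

lemma smooth_imp_differentiable: "f differentiable (at x)" if "smooth f"
proof -
  have "k_times_continuously_differentiable (Suc 0) f"
    using that unfolding smooth_def by blast
  then show ?thesis by simp
qed

lemma smooth_frechet_derivative: "smooth (\<lambda>x. frechet_derivative f (at x) v)" if "smooth f"
  unfolding smooth_def
proof
  fix k
  have "k_times_continuously_differentiable (Suc k) f"
    using that unfolding smooth_def by blast
  then show "k_times_continuously_differentiable k (\<lambda>x. frechet_derivative f (at x) v)" by simp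
qed

lemma differentiable_compose_bounded_linear:
  assumes "bounded_linear L" and "f differentiable (at (L x))"
  shows "(\<lambda>x. f (L x)) differentiable (at x)"
    and "frechet_derivative (\<lambda>x. f (L x)) (at x) v = frechet_derivative f (at (L x)) (L v)"
proof -
  have "((\<lambda>x. f (L x)) has_derivative (\<lambda>h. frechet_derivative f (at (L x)) (L h))) (at x)"
    using has_derivative_compose[OF bounded_linear_imp_has_derivative[OF assms(1)]
        frechet_derivative_works[THEN iffD1, OF assms(2)]] .
  then show "(\<lambda>x. f (L x)) differentiable (at x)"
    and "frechet_derivative (\<lambda>x. f (L x)) (at x) v = frechet_derivative f (at (L x)) (L v)"
    by (auto simp: differentiable_def frechet_derivative_at[symmetric])
qed

text \<open>
  A directional derivative of \<open>f \<circ> L\<close> is again a composite with \<open>L\<close>, of the derivative of \<open>f\<close>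
  along \<open>L v\<close>; hence the induction over the order has to vary \<open>f\<close>.
\<close>

lemma smooth_compose_bounded_linear:
  assumes L: "bounded_linear L" and "smooth f"
  shows "smooth (\<lambda>x. f (L x))"
proof -
  have "k_times_continuously_differentiable k f \<Longrightarrow>
      k_times_continuously_differentiable k (\<lambda>x. f (L x))" for k
  proof (induction k arbitrary: f)
    case 0
    then show ?case
      using continuous_on_compose2[of UNIV f UNIV L] linear_continuous_on[OF L] by simp
  next
    case (Suc k)
    have df: "f differentiable (at x)" for x
      using Suc.prems by simp
    have "k_times_continuously_differentiable k
        (\<lambda>x. frechet_derivative (\<lambda>x. f (L x)) (at x) v)" for v
    proof -
      have "k_times_continuously_differentiable k (\<lambda>y. frechet_derivative f (at y) (L v))"
        using Suc.prems by simp
      from Suc.IH[OF this] show ?thesis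
        unfolding differentiable_compose_bounded_linear(2)[OF L df] .
    qed
    then show ?case
      using differentiable_compose_bounded_linear(1)[OF L df] by simp
  qed
  then show ?thesis
    using assms(2) unfolding smooth_def by blast
qed

lemma has_vector_derivative_along_line:
  fixes f :: "'m::finite wavefun"
  assumes "f differentiable (at x)"
  shows "((\<lambda>t. f (x + t *\<^sub>R v)) has_vector_derivative frechet_derivative f (at x) v) (at 0)"
proof -
  have d: "(f has_derivative frechet_derivative f (at x)) (at (x + 0 *\<^sub>R v))"
    using frechet_derivative_works[THEN iffD1, OF assms] by simp
  have l: "((\<lambda>t. x + t *\<^sub>R v) has_derivative (\<lambda>t. t *\<^sub>R v)) (at 0)"
    by (auto intro!: derivative_eq_intros)
  show ?thesis
    using has_derivative_compose[OF l d]
    by (simp add: has_vector_derivative_def linear_cmul[OF linear_frechet_derivative[OF assms]])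
qed

lemma partial_eq_frechet_derivative:
  "partial k f x = frechet_derivative f (at x) (axis k 1)" if "f differentiable (at x)"
  unfolding partial_def
  using has_vector_derivative_along_line[OF that] by (rule vector_derivative_at)

lemma partial_cmult:
  "partial k (\<lambda>x. c * f x) x = c * partial k f x" if "f differentiable (at x)"
  unfolding partial_eq_frechet_derivative[OF that]
  unfolding partial_def
  using has_vector_derivative_mult_right[OF
      has_vector_derivative_along_line[OF that, of "axis k 1"], of c]
  by (rule vector_derivative_at)

lemma partial_diff_eq_frechet_derivative:
  assumes "f differentiable (at x)"
  shows "partial k f x - partial l f x = frechet_derivative f (at x) (axis k 1 - axis l 1)"
  by (simp add: partial_eq_frechet_derivative[OF assms]
      linear_diff[OF linear_frechet_derivative[OF assms]])

section \<open>Quantized momenta and exponentials\<close>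

text \<open>
  Stated for an abstract operator \<open>D\<close> that differentiates along \<open>v\<close>, so as to cover both a single
  partial derivative and a difference of two.
\<close>

lemma derivative_power2:
  fixes D :: "'m::finite wavefun \<Rightarrow> 'm wavefun"
  assumes "\<And>h x. smooth h \<Longrightarrow> D h x = frechet_derivative h (at x) v" and "smooth f"
  shows "(D ^^ 2) f x =
    frechet_derivative (\<lambda>x. frechet_derivative f (at x) v) (at x) v"
proof -
  have "D f = (\<lambda>x. frechet_derivative f (at x) v)"
    using assms by blast
  then show ?thesis
    by (simp add: numeral_2_eq_2 assms(1)[OF smooth_frechet_derivative[OF assms(2)]])
qed

text \<open>The two factors \<open>-\<i>\<close> combine to \<open>-1\<close> because \<open>D\<close> commutes with scalars on smooth functions.\<close>

lemma momentum_power2: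
  fixes D A :: "'m::finite wavefun \<Rightarrow> 'm wavefun"
  assumes A: "\<And>h x. A h x = - \<i> * D h x"
    and D: "\<And>h x. smooth h \<Longrightarrow> D h x = frechet_derivative h (at x) v"
    and cmult: "\<And>c h x. smooth h \<Longrightarrow> D (\<lambda>x. c * h x) x = c * D h x"
    and f: "smooth f"
  shows "(A ^^ 2) f x = - (D ^^ 2) f x"
proof -
  have Df: "D f = (\<lambda>x. frechet_derivative f (at x) v)"
    using D f by blast
  have Af: "A f = (\<lambda>x. - \<i> * D f x)"
    using A by blast
  have "(A ^^ 2) f x = - \<i> * D (\<lambda>x. - \<i> * D f x) x"
    by (simp only: numeral_2_eq_2 funpow.simps comp_apply id_apply Af A)
  also have "D (\<lambda>x. - \<i> * D f x) x = - \<i> * D (D f) x"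
    by (rule cmult) (simp only: Df smooth_frechet_derivative[OF f])
  finally show ?thesis
    by (simp add: numeral_2_eq_2)
qed

lemma op_exp_multiplication:
  fixes A :: "'m::finite wavefun \<Rightarrow> 'm wavefun"
  assumes "\<And>f x. A f x = complex_of_real (m x) * f x"
  shows "op_exp A f x = complex_of_real (exp (m x)) * f x"
proof -
  have pow: "(A ^^ k) f x = complex_of_real (m x) ^ k * f x" for k
    by (induction k) (simp_all add: assms)
  have "(\<lambda>k. complex_of_real (m x) ^ k /\<^sub>R fact k * f x) sums (exp (complex_of_real (m x)) * f x)"
    by (rule sums_mult2[OF exp_converges])
  also have "(\<lambda>k. complex_of_real (m x) ^ k /\<^sub>R fact k * f x) = (\<lambda>k. (A ^^ k) f x / fact k)"
    by (rule ext) (simp add: pow scaleR_conv_of_real divide_simps)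
  finally show ?thesis
    unfolding op_exp_def exp_of_real by (rule sums_unique[symmetric])
qed

text \<open>
  The term \<open>i = 1\<close> is split off because there the zero operator stands for \<open>p\<^sub>0\<close>, and not a
  partial derivative.
\<close>

lemma toda_quantum_H_smooth:
  fixes e :: "nat \<Rightarrow> 'm::finite"
  assumes n: "n \<ge> 2" and f: "smooth f"
  shows "toda_quantum_H n e f x =
    - 2 * (partial (e 1) ^^ 2) f x
    - 2 * (\<Sum>i=2..n-1. ((\<lambda>g x. partial (e i) g x - partial (e (i-1)) g x) ^^ 2) f x)
    + 4 * complex_of_real (\<Sum>i=1..n-1. exp (2 * x $ e i)) * f x"
proof -
  let ?p = "\<lambda>i. if i = 0 then (\<lambda>f x. 0) else momentum_op (e i)"
  let ?A = "\<lambda>i f x. ?p i f x - ?p (i - 1) f x"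
  have first: "(?A 1 ^^ 2) f x = - (partial (e 1) ^^ 2) f x"
    by (rule momentum_power2[where v = "axis (e 1) 1"])
       (auto simp: momentum_op_def smooth_imp_differentiable f
          intro!: partial_eq_frechet_derivative partial_cmult)
  have rest: "(?A i ^^ 2) f x = - ((\<lambda>g x. partial (e i) g x - partial (e (i-1)) g x) ^^ 2) f x"
    if "i \<in> {2..n-1}" for i
    by (rule momentum_power2[where v = "axis (e i) 1 - axis (e (i-1)) 1"])
       (use that in \<open>auto simp: momentum_op_def partial_cmult smooth_imp_differentiable f
          right_diff_distrib intro!: partial_diff_eq_frechet_derivative\<close>)
  have "(\<Sum>i=1..n-1. (?A i ^^ 2) f x) = (?A 1 ^^ 2) f x + (\<Sum>i=2..n-1. (?A i ^^ 2) f x)"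
    using n by (simp add: sum.atLeast_Suc_atMost numeral_2_eq_2)
  also have "(\<Sum>i=2..n-1. (?A i ^^ 2) f x) =
      - (\<Sum>i=2..n-1. ((\<lambda>g x. partial (e i) g x - partial (e (i-1)) g x) ^^ 2) f x)"
    by (simp only: rest sum_negf cong: sum.cong)
  finally have kinetic: "(\<Sum>i=1..n-1. (?A i ^^ 2) f x) = - (partial (e 1) ^^ 2) f x
      - (\<Sum>i=2..n-1. ((\<lambda>g x. partial (e i) g x - partial (e (i-1)) g x) ^^ 2) f x)"
    by (simp only: first) simp
  have potential: "op_exp ((\<lambda>f x. complex_of_real 2 * f x) \<circ> position_op (e i)) f x
      = complex_of_real (exp (2 * x $ e i)) * f x" for i
    by (rule op_exp_multiplication) (simp add: position_op_def)
  have "toda_quantum_H n e f x = 2 * (\<Sum>i=1..n-1. (?A i ^^ 2) f x)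
      + 4 * (\<Sum>i=1..n-1. complex_of_real (exp (2 * x $ e i)) * f x)"
    unfolding toda_quantum_H_def toda_H_def
    by (simp only: quantize.simps comp_apply potential) simp
  then show ?thesis
    unfolding kinetic by (simp add: sum_distrib_right[symmetric] right_diff_distrib)
qed

section \<open>The change of coordinates\<close>

lemma vec_eqI_enumerated:
  fixes u w :: "'a ^ 'm::finite"
  assumes "bij_betw e A UNIV" and "\<And>i. i \<in> A \<Longrightarrow> u $ e i = w $ e i"
  shows "u = w"
  unfolding vec_eq_iff
proof
  fix k
  obtain i where "i \<in> A" "k = e i"
    using bij_betw_imp_surj_on[OF assms(1)] by blast
  then show "u $ k = w $ k"
    using assms(2) by simp
qed

lemma toda_shift_linear:
  fixes e :: "nat \<Rightarrow> 'm::finite" and \<phi> :: "real ^ 'm \<Rightarrow> real ^ 'm"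
  assumes e: "bij_betw e {1..n-1} UNIV"
    and \<phi>: "\<And>z i. 1 \<le> i \<Longrightarrow> i < n-1 \<Longrightarrow> \<phi> z $ e i = z $ e i - z $ e (i+1)"
    and last: "\<And>z. \<phi> z $ e (n-1) = z $ e (n-1)"
  shows "linear \<phi>"
proof -
  have \<phi>_eq: "\<phi> z $ e i = z $ e i - (if i = n - 1 then 0 else z $ e (i+1))"
    if "i \<in> {1..n-1}" for i z
    using that \<phi>[of i z] last[of z] by auto
  show ?thesis
  proof (rule linearI)
    show "\<phi> (u + w) = \<phi> u + \<phi> w" for u w
      by (rule vec_eqI_enumerated[OF e]) (simp add: \<phi>_eq)
    show "\<phi> (c *\<^sub>R u) = c *\<^sub>R \<phi> u" for c u
      by (rule vec_eqI_enumerated[OF e]) (simp add: \<phi>_eq right_diff_distrib)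
  qed
qed

text \<open>Solving \<open>\<phi> z = 0\<close> from the last coordinate downwards shows that the kernel is trivial.\<close>

lemma toda_shift_bij:
  fixes e :: "nat \<Rightarrow> 'm::finite" and \<phi> :: "real ^ 'm \<Rightarrow> real ^ 'm"
  assumes e: "bij_betw e {1..n-1} UNIV"
    and \<phi>: "\<And>z i. 1 \<le> i \<Longrightarrow> i < n-1 \<Longrightarrow> \<phi> z $ e i = z $ e i - z $ e (i+1)"
    and last: "\<And>z. \<phi> z $ e (n-1) = z $ e (n-1)"
  shows "bij \<phi>"
proof -
  have lin: "linear \<phi>"
    by (rule toda_shift_linear) (fact assms)+
  have "z = 0" if z: "\<phi> z = 0" for z
  proof -
    have "z $ e i = 0" if "i \<le> n - 1" "1 \<le> i" for i
      using that
    proof (induction rule: inc_induct)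
      case base
      then show ?case using last[of z] z by simp
    next
      case (step i)
      then show ?case using \<phi>[of i z] z by simp
    qed
    then show ?thesis
      by (intro vec_eqI_enumerated[OF e]) simp
  qed
  then have "inj \<phi>"
    using linear_injective_0[OF lin] by blast
  then show ?thesis
    using linear_injective_imp_surjective[OF lin] by (simp add: bij_def)
qed

lemma toda_shift_axis:
  fixes e :: "nat \<Rightarrow> 'm::finite" and \<phi> :: "real ^ 'm \<Rightarrow> real ^ 'm"
  assumes e: "bij_betw e {1..n-1} UNIV"
    and \<phi>: "\<And>z i. 1 \<le> i \<Longrightarrow> i < n-1 \<Longrightarrow> \<phi> z $ e i = z $ e i - z $ e (i+1)"
    and last: "\<And>z. \<phi> z $ e (n-1) = z $ e (n-1)"
    and i: "i \<in> {1..n-1}"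
  shows "\<phi> (axis (e i) 1) = (if i = 1 then axis (e 1) 1 else axis (e i) 1 - axis (e (i-1)) 1)"
proof -
  have e_eq: "e k = e j \<longleftrightarrow> k = j" if "k \<in> {1..n-1}" "j \<in> {1..n-1}" for k j
    using bij_betw_imp_inj_on[OF e] that by (simp add: inj_on_eq_iff)
  have comp: "axis (e k) (1::real) $ e j = (if k = j then 1 else 0)"
    if "k \<in> {1..n-1}" "j \<in> {1..n-1}" for k j
    using e_eq[OF that] by (auto simp: axis_def)
  show ?thesis
  proof (rule vec_eqI_enumerated[OF e])
    fix j
    assume j: "j \<in> {1..n-1}"
    have lhs: "\<phi> (axis (e i) 1) $ e j = (if i = j then 1 else 0) - (if i = j + 1 then 1 else 0)"
    proof (cases "j = n - 1")
      case True
      then have "i \<noteq> j + 1" using i by auto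
      then show ?thesis using last[of "axis (e i) 1"] comp[OF i j] True by simp
    next
      case False
      then have "1 \<le> j" "j < n - 1" and j1: "j + 1 \<in> {1..n-1}" using j by auto
      then show ?thesis using \<phi>[of j "axis (e i) 1"] comp[OF i j] comp[OF i j1] by simp
    qed
    show "\<phi> (axis (e i) 1) $ e j =
        (if i = 1 then axis (e 1) 1 else axis (e i) 1 - axis (e (i-1)) 1) $ e j"
    proof (cases "i = 1")
      case True
      then have "i \<noteq> j + 1" using j by auto
      then show ?thesis using True lhs comp[OF i j] by simp
    next
      case False
      then have i1: "i - 1 \<in> {1..n-1}" and "i - 1 = j \<longleftrightarrow> i = j + 1" using i by auto
      then show ?thesis using False lhs comp[OF i j] comp[OF i1 j] by simp
    qed
  qed
qed

text \<open>
  Chain rule for an operator \<open>D\<close> that differentiates along \<open>\<phi> w\<close>; the inverse of a linear bijection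
  is again bounded linear, so \<open>g \<circ> inv \<phi>\<close> stays smooth.
\<close>

lemma derivative_power2_in_coordinates:
  fixes \<phi> :: "real ^ 'm \<Rightarrow> real ^ 'm" and D :: "'m::finite wavefun \<Rightarrow> 'm wavefun"
  assumes lin: "linear \<phi>" and bij: "bij \<phi>" and g: "smooth g"
    and D: "\<And>h x. smooth h \<Longrightarrow> D h x = frechet_derivative h (at x) (\<phi> w)"
  shows "(D ^^ 2) (\<lambda>x. g (inv \<phi> x)) (\<phi> z) =
    frechet_derivative (\<lambda>x. frechet_derivative g (at x) w) (at z) w"
proof -
  have inv_\<phi>: "inv \<phi> (\<phi> u) = u" for u
    using bij by (simp add: bij_is_inj)
  have "linear (inv \<phi>)"
    using lin bij inj_linear_imp_inv_linear bij_is_inj by blast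
  then have L: "bounded_linear (inv \<phi>)"
    by (rule linear_conv_bounded_linear[THEN iffD1])
  have chain: "frechet_derivative (\<lambda>x. h (inv \<phi> x)) (at x) (\<phi> w) =
      frechet_derivative h (at (inv \<phi> x)) w" if "smooth h" for h :: "'m wavefun" and x
    using differentiable_compose_bounded_linear(2)[OF L smooth_imp_differentiable[OF that]]
    by (simp add: inv_\<phi>)
  have "(D ^^ 2) (\<lambda>x. g (inv \<phi> x)) (\<phi> z) =
      frechet_derivative (\<lambda>x. frechet_derivative g (at (inv \<phi> x)) w) (at (\<phi> z)) (\<phi> w)"
    using derivative_power2[OF D smooth_compose_bounded_linear[OF L g]]
    by (simp only: chain[OF g])
  then show ?thesis
    unfolding chain[OF smooth_frechet_derivative[OF g]] inv_\<phi> .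
qed

lemma toda_quantum_H_in_coordinates:
  fixes e :: "nat \<Rightarrow> 'm::finite" and \<phi> :: "real ^ 'm \<Rightarrow> real ^ 'm"
  assumes n: "n \<ge> 2"
    and e: "bij_betw e {1..n-1} UNIV"
    and \<phi>: "\<And>z i. 1 \<le> i \<Longrightarrow> i < n-1 \<Longrightarrow> \<phi> z $ e i = z $ e i - z $ e (i+1)"
    and last: "\<And>z. \<phi> z $ e (n-1) = z $ e (n-1)"
    and g: "smooth g"
  shows "in_coordinates \<phi> (toda_quantum_H n e) g z =
    - 2 * (\<Sum>i=1..n-1. (partial (e i) ^^ 2) g z)
    + 4 * complex_of_real
        ((\<Sum>i=1..n-2. exp (2 * (z $ e i - z $ e (i+1)))) + exp (2 * z $ e (n-1))) * g z"
proof -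
  let ?f = "\<lambda>x. g (inv \<phi> x)"
  let ?D = "\<lambda>i g x. partial (e i) g x - partial (e (i-1)) g x"
  have lin: "linear \<phi>" and bij: "bij \<phi>"
    using toda_shift_linear[OF e \<phi> last] toda_shift_bij[OF e \<phi> last] by auto
  have "linear (inv \<phi>)"
    using lin bij inj_linear_imp_inv_linear bij_is_inj by blast
  then have f: "smooth ?f"
    using g by (rule smooth_compose_bounded_linear[OF linear_conv_bounded_linear[THEN iffD1]])
  have partial2: "(partial (e i) ^^ 2) g z =
      frechet_derivative (\<lambda>x. frechet_derivative g (at x) (axis (e i) 1)) (at z) (axis (e i) 1)"
    for i
    by (rule derivative_power2)
       (simp_all add: partial_eq_frechet_derivative smooth_imp_differentiable g)
  have first: "(partial (e 1) ^^ 2) ?f (\<phi> z) = (partial (e 1) ^^ 2) g z"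
    unfolding partial2
    by (rule derivative_power2_in_coordinates[OF lin bij g])
       (use n toda_shift_axis[OF e \<phi> last, of 1] in
         \<open>simp add: partial_eq_frechet_derivative smooth_imp_differentiable\<close>)
  have rest: "(?D i ^^ 2) ?f (\<phi> z) = (partial (e i) ^^ 2) g z" if "i \<in> {2..n-1}" for i
    unfolding partial2
    by (rule derivative_power2_in_coordinates[OF lin bij g])
       (use that toda_shift_axis[OF e \<phi> last, of i] in
         \<open>simp add: partial_diff_eq_frechet_derivative smooth_imp_differentiable\<close>)
  have kinetic: "(\<Sum>i=1..n-1. (partial (e i) ^^ 2) g z) =
      (partial (e 1) ^^ 2) ?f (\<phi> z) + (\<Sum>i=2..n-1. (?D i ^^ 2) ?f (\<phi> z))"
    using n unfolding first
    by (simp only: rest cong: sum.cong) (simp add: sum.atLeast_Suc_atMost numeral_2_eq_2)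
  have "(\<Sum>i=1..n-1. exp (2 * \<phi> z $ e i)) =
      (\<Sum>i=1..n-2. exp (2 * \<phi> z $ e i)) + exp (2 * \<phi> z $ e (n-1))"
  proof -
    have "n - 1 = Suc (n - 2)" using n by simp
    then show ?thesis by simp
  qed
  also have "(\<Sum>i=1..n-2. exp (2 * \<phi> z $ e i)) =
      (\<Sum>i=1..n-2. exp (2 * (z $ e i - z $ e (i+1))))"
    by (rule sum.cong) (use \<phi> in auto)
  finally have potential: "(\<Sum>i=1..n-1. exp (2 * \<phi> z $ e i)) =
      (\<Sum>i=1..n-2. exp (2 * (z $ e i - z $ e (i+1)))) + exp (2 * z $ e (n-1))"
    by (simp only: last)
  have "in_coordinates \<phi> (toda_quantum_H n e) g z = toda_quantum_H n e ?f (\<phi> z)"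
    by (simp add: in_coordinates_def comp_def)
  also have "\<dots> = - 2 * (partial (e 1) ^^ 2) ?f (\<phi> z) - 2 * (\<Sum>i=2..n-1. (?D i ^^ 2) ?f (\<phi> z))
      + 4 * complex_of_real (\<Sum>i=1..n-1. exp (2 * \<phi> z $ e i)) * ?f (\<phi> z)"
    by (rule toda_quantum_H_smooth[OF n f])
  also have "?f (\<phi> z) = g z"
    using bij by (simp add: bij_is_inj)
  finally show ?thesis
    unfolding kinetic potential by (simp only: distrib_left mult_minus_left) simp
qed

theorem mainTheorem5:
  fixes n :: nat and e :: "nat \<Rightarrow> 'm::finite" and \<phi> :: "real ^ 'm \<Rightarrow> real ^ 'm"
  assumes "n \<ge> 2"
    and "bij_betw e {1..n-1} UNIV"
    and "\<And>z i. 1 \<le> i \<Longrightarrow> i < n-1 \<Longrightarrow> \<phi> z $ e i = z $ e i - z $ e (i+1)"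
    and "\<And>z. \<phi> z $ e (n-1) = z $ e (n-1)"
  shows
    "(\<forall>c a b q p. toda_canonical_coordinates n c a b q p \<longrightarrow> p 0 = 0 \<longrightarrow>
        classical_value p q (toda_H n) =
          2 * (\<Sum>i=1..n-1. (p i - p (i-1))\<^sup>2) + 4 * (\<Sum>i=1..n-1. exp (2 * q i)))
     \<and> (\<forall>f. smooth f \<longrightarrow> toda_quantum_H n e f =
        (\<lambda>q. - 2 * (partial (e 1) ^^ 2) f q
             - 2 * (\<Sum>i=2..n-1. ((\<lambda>g x. partial (e i) g x - partial (e (i-1)) g x) ^^ 2) f q)
             + 4 * complex_of_real (\<Sum>i=1..n-1. exp (2 * q $ e i)) * f q))
     \<and> linear \<phi> \<and> bij \<phi>
     \<and> (\<forall>g. smooth g \<longrightarrow> in_coordinates \<phi> (toda_quantum_H n e) g =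
        (\<lambda>z. - 2 * (\<Sum>i=1..n-1. (partial (e i) ^^ 2) g z)
             + 4 * complex_of_real
                 ((\<Sum>i=1..n-2. exp (2 * (z $ e i - z $ e (i+1)))) + exp (2 * z $ e (n-1))) * g z))"
proof (intro conjI allI impI ext)
  show "classical_value p q (toda_H n) =
      2 * (\<Sum>i=1..n-1. (p i - p (i-1))\<^sup>2) + 4 * (\<Sum>i=1..n-1. exp (2 * q i))" for p q
    by (simp add: toda_H_def)
  show "linear \<phi>"
    by (rule toda_shift_linear) (fact assms)+
  show "bij \<phi>"
    by (rule toda_shift_bij) (fact assms)+
  show "toda_quantum_H n e f q =
      - 2 * (partial (e 1) ^^ 2) f q
      - 2 * (\<Sum>i=2..n-1. ((\<lambda>g x. partial (e i) g x - partial (e (i-1)) g x) ^^ 2) f q)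
      + 4 * complex_of_real (\<Sum>i=1..n-1. exp (2 * q $ e i)) * f q" if "smooth f" for f q
    by (rule toda_quantum_H_smooth[OF assms(1) that])
  show "in_coordinates \<phi> (toda_quantum_H n e) g z =
      - 2 * (\<Sum>i=1..n-1. (partial (e i) ^^ 2) g z)
      + 4 * complex_of_real
          ((\<Sum>i=1..n-2. exp (2 * (z $ e i - z $ e (i+1)))) + exp (2 * z $ e (n-1))) * g z"
    if "smooth g" for g z
    by (rule toda_quantum_H_in_coordinates) (fact assms that)+
qed

end
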